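(* Let $S\subset\mathbb Z_{>0}$ and $\epsilon>0$. (a) Assume that $\lim_{m\to\infty}\alpha_m^{\mathbf a}=\alpha$ vaguely for some subprobability measure $\alpha$ on $\mathbb R$, and that $\inf\mathbf a+\inf_{n\in S}\min\mathbf b_n>0$. Then, $\mathbf P$-almost surely, there exist a deterministic $\delta>0$ and a random $K\in\mathbb Z_{>0}$ such that $$\Big|\mathrm G^{\mathbf a,\mathbf b}(m,n)-m\int_{\mathbb R}\frac{\alpha(\mathrm da)}{a+\min\mathbf b_n}\Big|\le\epsilon m\qquad\text{for } m\in\mathbb Z_{\ge K}\text{ and } n\in S\text{ with } n\le\delta m.$$ (b) Assume that $\lim_{n\to\infty}\beta_n^{\mathbf b}=\beta$ vaguely for some subprobability measure $\beta$ on $\mathbb R$, and that $\inf\mathbf b+\inf_{m\in S}\min\mathbf a_m>0$. Then, $\mathbf P$-almost surely, there exist a deterministic $\delta>0$ and a random $K\in\mathbb Z_{>0}$ such that $$\Big|\mathrm G^{\mathbf a,\mathbf b}(m,n)-n\int_{\mathbb R}\frac{\beta(\mathrm db)}{b+\min\mathbf a_m}\Big|\le\epsilon n\qquad\text{for } n\in\mathbb Z_{\ge K}\text{ and } m\in S\text{ with } m\le\delta n.$$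
   Context: $[n]=\{1,\dots,n\}$; $\mathrm{Exp}(\lambda)$ is the exponential distribution with rate $\lambda$ (mean $1/\lambda$). Fix two collections of real parameters $\mathbf a=\{\mathbf a_m(i):m\in\mathbb Z_{>0},i\in[m]\}$ and $\mathbf b=\{\mathbf b_n(j):n\in\mathbb Z_{>0},j\in[n]\}$ such that $\mathbf a_m(i)+\mathbf b_n(j)>0$ for all $m,n\in\mathbb Z_{>0}$, $i\in[m]$, $j\in[n]$. Write $\min\mathbf a_m=\min_{i\in[m]}\mathbf a_m(i)$, $\min\mathbf b_n=\min_{j\in[n]}\mathbf b_n(j)$, $\inf\mathbf a=\inf_{m}\min\mathbf a_m$, $\inf\mathbf b=\inf_n\min\mathbf b_n$. Let $\alpha_m^{\mathbf a}=\frac1m\sum_{i=1}^m\delta_{\mathbf a_m(i)}$ and $\beta_n^{\mathbf b}=\frac1n\sum_{j=1}^n\delta_{\mathbf b_n(j)}$ be the empirical distributions. Vague convergence $\mu_n\to\mu$ of finite Borel measures on $\mathbb R$ means $\int f\,\mathrm d\mu_n\to\int f\,\mathrm d\mu$ for every continuous $f:\mathbb R\to\mathbb R$ vanishing at infinity. A subprobability measure is a nonnegative Borel measure of total mass at most $1$ (the zero measure is allowed). Let $(\Omega,\mathbf P)$ be $\Omega=\mathbb R^{\mathbb Z_{>0}^2}$ with the product measure under which the coordinates are i.i.d. $\mathrm{Exp}(1)$. For each $m,n\in\mathbb Z_{>0}$ let $\{\omega_{m,n}^{\mathbf a,\mathbf b}(i,j): i\in[m],j\in[n]\}$ be independent random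 variables on $(\Omega,\mathbf P)$ with $\omega_{m,n}^{\mathbf a,\mathbf b}(i,j)\sim\mathrm{Exp}(\mathbf a_m(i)+\mathbf b_n(j))$; no assumption is made about the joint distribution of these collections for different $(m,n)$. The last-passage time is $$\mathrm G^{\mathbf a,\mathbf b}(m,n)=\max_{\pi}\sum_{(i,j)\in\pi}\omega^{\mathbf a,\mathbf b}_{m,n}(i,j),$$ the maximum over all up-right lattice paths $\pi$ from $(1,1)$ to $(m,n)$ (steps $(1,0)$ or $(0,1)$). *)

theory Defs
  imports "HOL-Probability.Probability"
begin

text \<open>
  The positive integers are represented by the positive elements of \<^typ>\<open>nat\<close>. A collection
  of parameters is a function \<open>a :: nat \<Rightarrow> nat \<Rightarrow> real\<close>, where only the values \<open>a m i\<close> with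
  \<open>1 \<le> i \<le> m\<close> matter; both families of parameters have this shape.
\<close>

definition row_min :: "(nat \<Rightarrow> nat \<Rightarrow> real) \<Rightarrow> nat \<Rightarrow> real" where
  "row_min a m = Min (a m ` {1..m})"

text \<open>The infimum is taken in \<^typ>\<open>ereal\<close>, so that it is \<open>\<infinity>\<close> over the empty index set.\<close>

definition inf_row_min :: "(nat \<Rightarrow> nat \<Rightarrow> real) \<Rightarrow> nat set \<Rightarrow> ereal" where
  "inf_row_min a S = (INF m\<in>S. ereal (row_min a m))"

text \<open>
  The push-forward of the uniform distribution on \<open>{1..m}\<close> under \<open>a m\<close>; see
  \<open>emeasure_empirical\<close> below for the form \<open>1/m\<close> times the sum of the point masses.
\<close>

definition empirical :: "(nat \<Rightarrow> nat \<Rightarrow> real) \<Rightarrow> nat \<Rightarrow> real measure" where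
  "empirical a m = distr (uniform_count_measure {1..m}) borel (a m)"

definition vague_conv :: "(nat \<Rightarrow> real measure) \<Rightarrow> real measure \<Rightarrow> bool" where
  "vague_conv M N \<longleftrightarrow>
     (\<forall>f :: real \<Rightarrow> real. continuous_on UNIV f \<and> (f \<longlongrightarrow> 0) at_infinity \<longrightarrow>
        (\<lambda>n. integral\<^sup>L (M n) f) \<longlonglongrightarrow> integral\<^sup>L N f)"

definition exp_coordinates :: "(nat \<times> nat \<Rightarrow> real) measure" where
  "exp_coordinates =
     (\<Pi>\<^sub>M p\<in>{1..} \<times> {1..}. density lborel (\<lambda>x. ennreal (exponential_density 1 x)))"

definition up_right_paths :: "nat \<Rightarrow> nat \<Rightarrow> (nat \<times> nat) list set" where
  "up_right_paths m n =
     {\<pi>. \<pi> \<noteq> [] \<and> hd \<pi> = (1, 1) \<and> last \<pi> = (m, n) \<and>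
         successively (\<lambda>p q. q = (fst p + 1, snd p) \<or> q = (fst p, snd p + 1)) \<pi>}"

definition last_passage :: "(nat \<times> nat \<Rightarrow> real) \<Rightarrow> nat \<Rightarrow> nat \<Rightarrow> real" where
  "last_passage w m n = Max ((\<lambda>\<pi>. \<Sum>p\<leftarrow>\<pi>. w p) ` up_right_paths m n)"

lemma emeasure_empirical:
  assumes "m > 0" and "A \<in> sets borel"
  shows "emeasure (empirical a m) A = ennreal ((\<Sum>i=1..m. indicator A (a m i)) / real m)"
proof -
  have "emeasure (empirical a m) A
      = emeasure (uniform_count_measure {1..m}) (a m -` A \<inter> {1..m})"
    unfolding empirical_def using assms
    by (subst emeasure_distr)
       (auto simp: space_uniform_count_measure measurable_def sets_uniform_count_measure)
  also have "\<dots> = ennreal (real (card (a m -` A \<inter> {1..m})) / real m)"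
    by (subst emeasure_uniform_count_measure) auto
  also have "real (card (a m -` A \<inter> {1..m})) = (\<Sum>i=1..m. indicator A (a m i))"
    by (simp add: indicator_def sum.If_cases Int_def vimage_def conj_commute)
  finally show ?thesis .
qed

lemma prob_space_exp_coordinates: "prob_space exp_coordinates"
  unfolding exp_coordinates_def
  by (intro prob_space_PiM prob_space_exponential_density) simp

lemma up_right_paths_snoc:
  assumes "successively (\<lambda>p q. q = (fst p + 1, snd p) \<or> q = (fst p, snd p + 1)) \<pi>" "\<pi> \<noteq> []"
  shows "length \<pi> + fst (hd \<pi>) + snd (hd \<pi>) = fst (last \<pi>) + snd (last \<pi>) + (1::nat)
       \<and> (\<forall>p\<in>set \<pi>. fst p \<le> fst (last \<pi>) \<and> snd p \<le> snd (last \<pi>))"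
  using assms
proof (induction \<pi>)
  case (Cons p \<pi>)
  show ?case
  proof (cases \<pi>)
    case (Cons q ps)
    with Cons.IH Cons.prems show ?thesis by fastforce
  qed auto
qed simp

lemma finite_up_right_paths: "finite (up_right_paths m n)"
proof (rule finite_subset)
  show "up_right_paths m n \<subseteq> {\<pi>. set \<pi> \<subseteq> {..m} \<times> {..n} \<and> length \<pi> \<le> m + n}"
    using up_right_paths_snoc by (fastforce simp: up_right_paths_def)
  show "finite {\<pi>. set \<pi> \<subseteq> {..m} \<times> {..n} \<and> length \<pi> \<le> m + n}"
    by (intro finite_lists_length_le) auto
qed

lemma up_right_paths_nonempty:
  assumes "m > 0" and "n > 0"
  shows "up_right_paths m n \<noteq> {}"
proof -
  have row: "up_right_paths m 1 \<noteq> {}" if "m > 0" for m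
    using that
  proof (induction m rule: nat_induct_non_zero)
    case 1
    have "[(1, 1)] \<in> up_right_paths 1 1" by (simp add: up_right_paths_def)
    then show ?case by blast
  next
    case (Suc m)
    then obtain \<pi> where "\<pi> \<in> up_right_paths m 1" by blast
    then have "\<pi> @ [(Suc m, 1)] \<in> up_right_paths (Suc m) 1"
      by (auto simp: up_right_paths_def successively_append_iff)
    then show ?case by blast
  qed
  show ?thesis
    using assms(2)
  proof (induction n rule: nat_induct_non_zero)
    case 1
    show ?case using row assms(1) by simp
  next
    case (Suc n)
    then obtain \<pi> where "\<pi> \<in> up_right_paths m n" by blast
    then have "\<pi> @ [(m, Suc n)] \<in> up_right_paths m (Suc n)"
      by (auto simp: up_right_paths_def successively_append_iff)
    then show ?case by blast
  qed
qed

end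

theory Submission
  imports Defs
begin

text \<open>
  Let \<open>n\<close> be much smaller than \<open>m\<close>, write \<open>\<rho> i = a m i + row_min b n\<close> for the smallest rate in
  column \<open>i\<close> and \<open>s\<close> for the sum of the means \<open>1 / \<rho> i\<close>. A path to \<open>(m, n)\<close> visits every column, and
  it has only \<open>n - 1\<close> vertices more than there are columns. So it collects, up to an error small
  against \<open>m\<close>, one weight for each column; the best choice is the row in which \<open>b n\<close> is minimal,
  which has the largest means in all columns at once. Hence the last-passage time \<open>G\<close> should be
  close to \<open>s\<close>, and vague convergence turns \<open>s / m\<close> into the integral.

  Both deviations from \<open>s\<close> are controlled by exponential moments. The lower bound needs only one
  path, through the best row (\<open>last_passage_lower_tail\<close>). For the upper bound, \<open>exp (\<theta> G)\<close> is at
  most the sum over all paths of the exponentials of their passage times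
  (\<open>last_passage_upper_tail\<close>); the number of paths has an exponential rate in \<open>m\<close> that tends to \<open>0\<close>
  with \<open>n / m\<close> (\<open>sum_prod_up_right_paths_le\<close>), so it is harmless for \<open>n \<le> \<delta> m\<close>. The probability
  of a deviation of order \<open>m\<close> then decays exponentially in \<open>m\<close>, uniformly in \<open>n \<le> \<delta> m\<close>
  (\<open>last_passage_deviation\<close>). There are at most \<open>m\<close> such \<open>n\<close>, so the Borel-Cantelli lemma
  applies, whatever the joint law of the weights for different \<open>(m, n)\<close>.

  What remains is deterministic: the convergence of \<open>s / m\<close> must be uniform in the shift
  \<open>row_min b n\<close>, which ranges over an unbounded interval
  (\<open>uniform_convergence_reciprocal_mean\<close>). The second half of the theorem is the first one for the
  weights reflected in the diagonal.
\<close>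

section \<open>Moment generating functions of exponential variables\<close>

lemma nn_integral_exp_exponential_density:
  fixes r \<theta> :: real
  assumes "0 < r" "\<theta> < r"
  shows "(\<integral>\<^sup>+x. ennreal (exponential_density r x) * ennreal (exp (\<theta> * x)) \<partial>lborel) = ennreal (r / (r - \<theta>))"
proof -
  interpret D: prob_space "density lborel (exponential_density (r - \<theta>))"
    using assms by (intro prob_space_exponential_density) simp
  \<comment> \<open>Tilting turns the density into a multiple of the exponential density of rate \<open>r - \<theta>\<close>.\<close>
  have "ennreal (exponential_density r x) * ennreal (exp (\<theta> * x))
      = ennreal (r / (r - \<theta>)) * ennreal (exponential_density (r - \<theta>) x)" for x
  proof -
    have "exp (- x * r) * exp (\<theta> * x) = exp (- x * (r - \<theta>))"
      by (simp add: exp_add[symmetric] algebra_simps)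
    then have "exponential_density r x * exp (\<theta> * x) = r / (r - \<theta>) * exponential_density (r - \<theta>) x"
      using assms by (simp add: exponential_density_def)
    then show ?thesis
      using assms by (simp add: ennreal_mult[symmetric] exponential_density_def del: times_divide_eq_left)
  qed
  then have "(\<integral>\<^sup>+x. ennreal (exponential_density r x) * ennreal (exp (\<theta> * x)) \<partial>lborel)
      = ennreal (r / (r - \<theta>)) * (\<integral>\<^sup>+x. ennreal (exponential_density (r - \<theta>) x) \<partial>lborel)"
    by (simp add: nn_integral_cmult)
  also have "(\<integral>\<^sup>+x. ennreal (exponential_density (r - \<theta>) x) \<partial>lborel) = 1"
    using D.emeasure_space_1 by (simp add: emeasure_density)
  finally show ?thesis by simp
qed

text \<open>
  The exponent is the mean contribution \<open>\<theta> / r\<close> with an error quadratic in \<open>\<theta>\<close>, so a deviation,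
  which gains a linear term in \<open>\<theta>\<close>, wins for small \<open>\<theta>\<close>. Negative \<open>\<theta>\<close> serves the lower tail.
\<close>
lemma exponential_mgf_le:
  fixes r \<theta> :: real
  assumes "0 < r" "\<bar>\<theta>\<bar> \<le> r / 2"
  shows "r / (r - \<theta>) \<le> exp (\<theta> / r + 2 * (\<theta> / r)\<^sup>2)"
proof -
  have u: "\<bar>- (\<theta> / r)\<bar> \<le> 1 / 2" using assms by (auto simp: field_simps)
  have pos: "0 < 1 + - (\<theta> / r)" using u by linarith
  have "r / (r - \<theta>) = 1 / (1 + - (\<theta> / r))" using assms by (simp add: field_simps)
  also have "\<dots> = exp (- ln (1 + - (\<theta> / r)))" using pos by (simp add: exp_minus field_simps)
  also have "\<dots> \<le> exp (\<theta> / r + 2 * (\<theta> / r)\<^sup>2)"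
    using abs_ln_one_plus_x_minus_x_bound[OF u] by (auto simp: abs_le_iff)
  finally show ?thesis .
qed

lemma (in prob_space) nn_integral_exp_sum_exponential:
  fixes X :: "'i \<Rightarrow> 'a \<Rightarrow> real" and r :: "'i \<Rightarrow> real" and \<theta> :: real
  assumes indep: "indep_vars (\<lambda>_. borel) X I" and J: "finite J" "J \<subseteq> I"
    and dist: "\<And>p. p \<in> J \<Longrightarrow> distributed M lborel (X p) (\<lambda>x. ennreal (exponential_density (r p) x))"
    and r: "\<And>p. p \<in> J \<Longrightarrow> 0 < r p \<and> \<theta> < r p"
  shows "(\<integral>\<^sup>+x. ennreal (exp (\<theta> * (\<Sum>p\<in>J. X p x))) \<partial>M) = ennreal (\<Prod>p\<in>J. r p / (r p - \<theta>))"
proof -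
  have "indep_vars (\<lambda>_. borel) (\<lambda>p x. ennreal (exp (\<theta> * X p x))) J"
    by (rule indep_vars_compose2[OF indep_vars_subset[OF indep J(2)]]) measurable
  then have "(\<integral>\<^sup>+x. (\<Prod>p\<in>J. ennreal (exp (\<theta> * X p x))) \<partial>M)
      = (\<Prod>p\<in>J. \<integral>\<^sup>+x. ennreal (exp (\<theta> * X p x)) \<partial>M)"
    by (intro indep_vars_nn_integral J) auto
  also have "\<dots> = (\<Prod>p\<in>J. ennreal (r p / (r p - \<theta>)))"
  proof (rule prod.cong)
    fix p assume p: "p \<in> J"
    show "(\<integral>\<^sup>+x. ennreal (exp (\<theta> * X p x)) \<partial>M) = ennreal (r p / (r p - \<theta>))"
      using r[OF p] distributed_nn_integral[OF dist[OF p], of "\<lambda>x. ennreal (exp (\<theta> * x))"]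
      by (simp add: nn_integral_exp_exponential_density)
  qed simp
  also have "\<dots> = ennreal (\<Prod>p\<in>J. r p / (r p - \<theta>))"
    using r by (intro prod_ennreal) (auto intro!: divide_nonneg_nonneg simp: less_imp_le)
  also have "(\<lambda>x. \<Prod>p\<in>J. ennreal (exp (\<theta> * X p x))) = (\<lambda>x. ennreal (exp (\<theta> * (\<Sum>p\<in>J. X p x))))"
    using J(1) by (simp add: prod_ennreal exp_sum[symmetric] sum_distrib_left)
  finally show ?thesis .
qed

section \<open>Up-right paths\<close>

abbreviation lattice_step :: "nat \<times> nat \<Rightarrow> nat \<times> nat \<Rightarrow> bool" where
  "lattice_step p q \<equiv> q = (fst p + 1, snd p) \<or> q = (fst p, snd p + 1)"

lemma up_right_path_distinct:
  assumes "\<pi> \<in> up_right_paths m n"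
  shows "distinct \<pi>"
proof -
  have "successively lattice_step \<pi>" using assms by (simp add: up_right_paths_def)
  then have "successively (\<lambda>p q. fst p + snd p < fst q + snd q) \<pi>"
    by (rule successively_mono) auto
  then have "sorted_wrt (\<lambda>p q. fst p + snd p < fst q + snd q) \<pi>"
    by (subst (asm) successively_conv_sorted_wrt) (auto simp: transp_def)
  then show ?thesis by (induction \<pi>) auto
qed

lemma up_right_path_in_grid:
  assumes "\<pi> \<in> up_right_paths m n"
  shows "set \<pi> \<subseteq> {1..m} \<times> {1..n}"
proof -
  have st: "successively lattice_step \<pi>" and ne: "\<pi> \<noteq> []" and hd: "hd \<pi> = (1, 1)"
    and last: "last \<pi> = (m, n)"
    using assms by (auto simp: up_right_paths_def)
  have "successively (\<lambda>p q. fst p \<le> fst q \<and> snd p \<le> snd q) \<pi>"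
    using st by (rule successively_mono) auto
  then have "sorted_wrt (\<lambda>p q. fst p \<le> fst q \<and> snd p \<le> snd q) \<pi>"
    by (subst (asm) successively_conv_sorted_wrt) (auto simp: transp_def)
  then have "\<forall>p\<in>set \<pi>. 1 \<le> fst p \<and> 1 \<le> snd p"
    using ne hd by (cases \<pi>) auto
  moreover have "\<forall>p\<in>set \<pi>. fst p \<le> m \<and> snd p \<le> n"
    using up_right_paths_snoc[OF st ne] last by simp
  ultimately show ?thesis by (intro subsetI) (simp add: mem_Times_iff)
qed

lemma up_right_paths_0: "up_right_paths 0 n = {}" "up_right_paths m 0 = {}"
proof -
  have "(m, n) \<in> {1..m} \<times> {1..n}" if "\<pi> \<in> up_right_paths m n" for \<pi> m n
    using up_right_path_in_grid[OF that] that last_in_set[of \<pi>] by (auto simp: up_right_paths_def)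
  then show "up_right_paths 0 n = {}" "up_right_paths m 0 = {}" by fastforce+
qed

lemma up_right_paths_append:
  assumes "\<pi> \<in> up_right_paths m n" "lattice_step (m, n) q"
  shows "\<pi> @ [q] \<in> up_right_paths (fst q) (snd q)"
  using assms by (auto simp: up_right_paths_def successively_append_iff)

lemma up_right_paths_subset_snoc:
  assumes "(m, n) \<noteq> (1, 1)"
  shows "up_right_paths m n \<subseteq> (\<lambda>\<pi>. \<pi> @ [(m, n)]) ` (up_right_paths (m - 1) n \<union> up_right_paths m (n - 1))"
proof
  fix \<pi> assume \<pi>: "\<pi> \<in> up_right_paths m n"
  then have ne: "\<pi> \<noteq> []" and last: "last \<pi> = (m, n)" by (auto simp: up_right_paths_def)
  define \<rho> where "\<rho> = butlast \<pi>"
  have eq: "\<pi> = \<rho> @ [(m, n)]" using append_butlast_last_id[OF ne] last by (simp add: \<rho>_def)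
  have ne': "\<rho> \<noteq> []" using \<pi> assms eq by (auto simp: up_right_paths_def)
  have "lattice_step (last \<rho>) (m, n)" and \<rho>: "successively lattice_step \<rho>" "hd \<rho> = (1, 1)"
    using \<pi> ne' unfolding eq by (auto simp: up_right_paths_def successively_append_iff)
  then have "last \<rho> = (m - 1, n) \<or> last \<rho> = (m, n - 1)" by (cases "last \<rho>") auto
  then show "\<pi> \<in> (\<lambda>\<pi>. \<pi> @ [(m, n)]) ` (up_right_paths (m - 1) n \<union> up_right_paths m (n - 1))"
    using \<rho> ne' eq by (auto simp: up_right_paths_def)
qed

lemma up_right_path_through_row:
  assumes "0 < m" "1 \<le> j" "j \<le> n"
  shows "\<exists>\<pi>\<in>up_right_paths m n. {1..m} \<times> {j} \<subseteq> set \<pi>"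
proof -
  have row: "\<exists>\<pi>\<in>up_right_paths m j. {1..m} \<times> {j} \<subseteq> set \<pi>"
    using assms(1)
  proof (induction m rule: nat_induct_non_zero)
    case 1
    obtain \<pi> where \<pi>: "\<pi> \<in> up_right_paths 1 j"
      using up_right_paths_nonempty[of 1 j] assms(2) by auto
    then have "(1, j) \<in> set \<pi>" using last_in_set[of \<pi>] by (auto simp: up_right_paths_def)
    with \<pi> show ?case by (intro bexI[of _ \<pi>]) auto
  next
    case (Suc k)
    then obtain \<pi> where "\<pi> \<in> up_right_paths k j" "{1..k} \<times> {j} \<subseteq> set \<pi>" by blast
    then show ?case
      using up_right_paths_append[of \<pi> k j "(Suc k, j)"]
      by (intro bexI[of _ "\<pi> @ [(Suc k, j)]"]) (auto simp: atLeastAtMostSuc_conv)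
  qed
  show ?thesis
    using assms(3)
  proof (induction n rule: dec_induct)
    case base
    show ?case by (rule row)
  next
    case (step l)
    then obtain \<pi> where "\<pi> \<in> up_right_paths m l" "{1..m} \<times> {j} \<subseteq> set \<pi>" by blast
    then show ?case
      using up_right_paths_append[of \<pi> m l "(m, Suc l)"]
      by (intro bexI[of _ "\<pi> @ [(m, Suc l)]"]) auto
  qed
qed

lemma up_right_paths_swap: "up_right_paths n m = map prod.swap ` up_right_paths m n"
proof -
  have "map prod.swap \<pi> \<in> up_right_paths n m" if "\<pi> \<in> up_right_paths m n" for \<pi> m n
  proof -
    have "successively (\<lambda>p q. lattice_step (prod.swap p) (prod.swap q)) \<pi>"
      using that by (auto simp: up_right_paths_def intro: successively_mono)
    then show ?thesis
      using that by (auto simp: up_right_paths_def successively_map hd_map last_map)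
  qed
  note this[of _ m n] this[of _ n m]
  moreover have "map prod.swap (map prod.swap \<pi>) = \<pi>" for \<pi> :: "(nat \<times> nat) list"
    by (simp add: comp_def)
  ultimately show ?thesis by (intro equalityI subsetI) (metis imageI, blast)
qed

lemma last_passage_swap: "last_passage w n m = last_passage (\<lambda>p. w (prod.swap p)) m n"
  unfolding last_passage_def up_right_paths_swap[of n m] image_image by (simp add: comp_def)

lemma last_passage_conv_sum_set:
  "last_passage w m n = Max ((\<lambda>\<pi>. \<Sum>p\<in>set \<pi>. w p) ` up_right_paths m n)"
  unfolding last_passage_def
  by (intro arg_cong[where f = Max] image_cong refl)
     (simp add: sum_list_distinct_conv_sum_set up_right_path_distinct)

text \<open>
  There are many paths, but each path leaves a column only once and has few steps in the other
  direction: giving weight \<open>1 - \<gamma>\<close> to a horizontal and \<open>\<gamma>\<close> to a vertical step, the total weight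
  of the paths is at most \<open>1\<close>. So the sum over all paths costs a factor \<open>1 / (1 - \<gamma>)\<close> for each
  column, close to \<open>1\<close>, and a large factor only for each row; the row factor also absorbs the
  weights of the additional vertices that a path has in a column.
\<close>
lemma sum_prod_up_right_paths_le:
  fixes w :: "nat \<times> nat \<Rightarrow> real" and u :: "nat \<Rightarrow> real" and D \<gamma> :: real
  assumes w: "\<And>i j. i \<in> {1..m} \<Longrightarrow> j \<in> {1..n} \<Longrightarrow> 0 \<le> w (i, j) \<and> w (i, j) \<le> u i"
    and u: "\<And>i. i \<in> {1..m} \<Longrightarrow> 0 \<le> u i \<and> u i \<le> D"
    and D: "1 \<le> D" and \<gamma>: "0 < \<gamma>" "\<gamma> < 1"
  shows "(\<Sum>\<pi>\<in>up_right_paths m n. \<Prod>p\<in>set \<pi>. w p) \<le> (\<Prod>i=1..m. u i / (1 - \<gamma>)) * (D / \<gamma>) ^ n"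
proof -
  define W where "W k l = (\<Sum>\<pi>\<in>up_right_paths k l. prod_list (map w \<pi>))" for k l
  define U where "U k l = (\<Prod>i=1..k. u i / (1 - \<gamma>)) * (D / \<gamma>) ^ l" for k l
  have U_nonneg: "0 \<le> U k l" if "k \<le> m" for k l
    unfolding U_def using that u \<gamma> D by (intro mult_nonneg_nonneg prod_nonneg) auto
  have "W k l \<le> U k l" if "k \<le> m" "l \<le> n" for k l
    using that
  proof (induction "k + l" arbitrary: k l rule: less_induct)
    case less
    consider "k = 0 \<or> l = 0" | "k = 1" "l = 1" | "1 \<le> k" "1 \<le> l" "(k, l) \<noteq> (1, 1)" by fastforce
    then show ?case
    proof cases
      case 1
      then have "W k l = 0" by (auto simp: W_def up_right_paths_0)
      then show ?thesis using U_nonneg[of k l] less.prems by simp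
    next
      case 2
      have one: "up_right_paths 1 1 \<subseteq> {[(1, 1)]}"
      proof
        fix \<pi> assume \<pi>: "\<pi> \<in> up_right_paths 1 1"
        then have "\<pi> \<noteq> []" "hd \<pi> = (1, 1)" by (auto simp: up_right_paths_def)
        then obtain \<rho> where \<rho>: "\<pi> = (1, 1) # \<rho>" by (cases \<pi>) auto
        moreover have "\<rho> = []"
          using up_right_path_in_grid[OF \<pi>] up_right_path_distinct[OF \<pi>] unfolding \<rho>
          by (cases \<rho>) auto
        ultimately show "\<pi> \<in> {[(1, 1)]}" by simp
      qed
      have u1: "0 \<le> w (1, 1)" "w (1, 1) \<le> u 1" "0 \<le> u 1" using w[of 1 1] u[of 1] less.prems 2 by auto
      have "W 1 1 \<le> (\<Sum>\<pi>\<in>{[(1, 1)]}. prod_list (map w \<pi>))"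
        unfolding W_def using u1 by (intro sum_mono2 one) auto
      also have "\<dots> \<le> u 1" using u1 by simp
      also have "\<dots> \<le> u 1 * ((1 / (1 - \<gamma>)) * (D / \<gamma>))"
      proof -
        have "1 * 1 \<le> (1 / (1 - \<gamma>)) * (D / \<gamma>)" using \<gamma> D by (intro mult_mono) auto
        from mult_left_mono[OF this u1(3)] show ?thesis by simp
      qed
      also have "\<dots> = U 1 1" by (simp add: U_def)
      finally show ?thesis using 2 by simp
    next
      case 3
      let ?s = "\<lambda>\<pi>. \<pi> @ [(k, l)]" and ?A = "up_right_paths (k - 1) l" and ?B = "up_right_paths k (l - 1)"
      have wkl: "0 \<le> w (k, l)" "w (k, l) \<le> u k" "u k \<le> D" using w[of k l] u[of k] 3 less.prems by auto
      have nonneg: "0 \<le> prod_list (map w \<pi>)" if "\<pi> \<in> up_right_paths k' l'" "k' \<le> m" "l' \<le> n" for \<pi> k' l'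
      proof (rule prod_list_nonneg)
        fix y assume "y \<in> set (map w \<pi>)"
        then obtain i j where y: "y = w (i, j)" "(i, j) \<in> set \<pi>" by auto
        with up_right_path_in_grid[OF that(1)] that(2,3) have "i \<in> {1..m}" "j \<in> {1..n}" by auto
        then show "0 \<le> y" using w y(1) by blast
      qed
      have fin: "finite ?A" "finite ?B" by (rule finite_up_right_paths)+
      have "W k l \<le> (\<Sum>\<pi>\<in>?s ` (?A \<union> ?B). prod_list (map w \<pi>))"
        unfolding W_def
      proof (intro sum_mono2 up_right_paths_subset_snoc 3)
        fix \<pi> assume "\<pi> \<in> ?s ` (?A \<union> ?B) - up_right_paths k l"
        then show "0 \<le> prod_list (map w \<pi>)" using nonneg less.prems wkl by auto
      qed (use fin in auto)
      also have "\<dots> = (\<Sum>\<pi>\<in>?A \<union> ?B. prod_list (map w \<pi>)) * w (k, l)"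
        by (subst sum.reindex) (auto simp: inj_on_def sum_distrib_right)
      also have "\<dots> \<le> (W (k - 1) l + W k (l - 1)) * w (k, l)"
      proof (rule mult_right_mono[OF _ wkl(1)])
        have "sum (\<lambda>\<pi>. prod_list (map w \<pi>)) (?A \<inter> ?B) \<ge> 0"
          using nonneg less.prems by (intro sum_nonneg) auto
        then show "(\<Sum>\<pi>\<in>?A \<union> ?B. prod_list (map w \<pi>)) \<le> W (k - 1) l + W k (l - 1)"
          using sum.union_inter[OF fin, of "\<lambda>\<pi>. prod_list (map w \<pi>)"] by (simp add: W_def)
      qed
      also have "\<dots> \<le> (U (k - 1) l + U k (l - 1)) * w (k, l)"
        using less.hyps[of "k - 1" l] less.hyps[of k "l - 1"] 3 less.prems wkl(1)
        by (intro mult_right_mono add_mono) auto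
      also have "\<dots> \<le> U (k - 1) l * u k + U k (l - 1) * D"
        unfolding distrib_right using wkl less.prems
        by (intro add_mono mult_left_mono U_nonneg) auto
      also have "U (k - 1) l * u k = (1 - \<gamma>) * U k l"
      proof -
        obtain k' where k': "k = Suc k'" using 3 by (cases k) auto
        show ?thesis using \<gamma> by (simp add: U_def k')
      qed
      also have "U k (l - 1) * D = \<gamma> * U k l"
      proof -
        obtain l' where l': "l = Suc l'" using 3 by (cases l) auto
        show ?thesis using \<gamma> by (simp add: U_def l')
      qed
      also have "(1 - \<gamma>) * U k l + \<gamma> * U k l = U k l" by (simp add: algebra_simps)
      finally show ?thesis .
    qed
  qed
  then have "W m n \<le> U m n" by simp
  also have "W m n = (\<Sum>\<pi>\<in>up_right_paths m n. \<Prod>p\<in>set \<pi>. w p)"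
    unfolding W_def by (intro sum.cong refl) (simp add: prod.distinct_set_conv_list up_right_path_distinct)
  finally show ?thesis by (simp add: U_def)
qed

section \<open>Large deviations of the last-passage time\<close>

lemma (in prob_space) borel_measurable_last_passage:
  assumes "\<And>p. p \<in> {1..m} \<times> {1..n} \<Longrightarrow> X p \<in> borel_measurable M"
  shows "(\<lambda>x. last_passage (\<lambda>p. X p x) m n) \<in> borel_measurable M"
  unfolding last_passage_conv_sum_set
  using assms up_right_path_in_grid
  by (intro borel_measurable_Max finite_up_right_paths borel_measurable_sum) blast

lemma (in prob_space) chernoff_bound:
  fixes Y :: "'a \<Rightarrow> real"
  assumes [measurable]: "Y \<in> borel_measurable M"
  shows "emeasure M {x \<in> space M. s \<le> \<theta> * Y x}
    \<le> ennreal (exp (- s)) * (\<integral>\<^sup>+x. ennreal (exp (\<theta> * Y x)) \<partial>M)"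
proof -
  have "emeasure M {x \<in> space M. s \<le> \<theta> * Y x} = (\<integral>\<^sup>+x. indicator {x \<in> space M. s \<le> \<theta> * Y x} x \<partial>M)"
    by (rule nn_integral_indicator[symmetric]) measurable
  also have "\<dots> \<le> (\<integral>\<^sup>+x. ennreal (exp (- s)) * ennreal (exp (\<theta> * Y x)) \<partial>M)"
    by (intro nn_integral_mono)
       (auto simp: indicator_def ennreal_mult[symmetric] exp_add[symmetric] ennreal_1[symmetric] simp del: ennreal_1)
  also have "\<dots> = ennreal (exp (- s)) * (\<integral>\<^sup>+x. ennreal (exp (\<theta> * Y x)) \<partial>M)"
    by (rule nn_integral_cmult) measurable
  finally show ?thesis .
qed

text \<open>
  Markov's inequality for \<open>exp (\<theta> G)\<close>, where the exponential of a maximum is replaced by the sum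
  over all paths. With \<open>2 * \<theta> \<le> \<rho> i\<close> a single weight contributes a factor of at most \<open>2\<close>; this is
  the constant in the factor for each row.
\<close>
lemma (in prob_space) last_passage_upper_tail:
  fixes X :: "nat \<times> nat \<Rightarrow> 'a \<Rightarrow> real" and r :: "nat \<times> nat \<Rightarrow> real" and \<rho> :: "nat \<Rightarrow> real"
  assumes indep: "indep_vars (\<lambda>_. borel) X ({1..m} \<times> {1..n})"
    and dist: "\<And>p. p \<in> {1..m} \<times> {1..n} \<Longrightarrow>
      distributed M lborel (X p) (\<lambda>x. ennreal (exponential_density (r p) x))"
    and r: "\<And>i j. i \<in> {1..m} \<Longrightarrow> j \<in> {1..n} \<Longrightarrow> \<rho> i \<le> r (i, j)"
    and \<rho>: "\<And>i. i \<in> {1..m} \<Longrightarrow> 2 * \<theta> \<le> \<rho> i"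
    and \<theta>: "0 < \<theta>" and \<gamma>: "0 < \<gamma>" "\<gamma> < 1" and mn: "0 < m" "0 < n"
  shows "emeasure M {x \<in> space M. s \<le> last_passage (\<lambda>p. X p x) m n}
    \<le> ennreal (exp (- (\<theta> * s)) * ((\<Prod>i=1..m. \<rho> i / (\<rho> i - \<theta>) / (1 - \<gamma>)) * (2 / \<gamma>) ^ n))"
proof -
  let ?P = "up_right_paths m n" and ?G = "\<lambda>x. last_passage (\<lambda>p. X p x) m n"
  have rv: "X p \<in> borel_measurable M" if "p \<in> {1..m} \<times> {1..n}" for p
    using distributed_measurable[OF dist[OF that]] by simp
  note fin = finite_up_right_paths
  have r_pos: "0 < r p \<and> \<theta> < r p" if "p \<in> {1..m} \<times> {1..n}" for p
    using r[of "fst p" "snd p"] \<rho>[of "fst p"] \<theta> that by auto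
  have "(\<integral>\<^sup>+x. ennreal (exp (\<theta> * ?G x)) \<partial>M)
      \<le> (\<integral>\<^sup>+x. (\<Sum>\<pi>\<in>?P. ennreal (exp (\<theta> * (\<Sum>p\<in>set \<pi>. X p x)))) \<partial>M)"
  proof (rule nn_integral_mono)
    fix x
    have "?G x \<in> (\<lambda>\<pi>. \<Sum>p\<in>set \<pi>. X p x) ` ?P"
      unfolding last_passage_conv_sum_set using up_right_paths_nonempty[OF mn] fin by (intro Max_in) auto
    then obtain \<pi> where "\<pi> \<in> ?P" and "?G x = (\<Sum>p\<in>set \<pi>. X p x)" by blast
    then show "ennreal (exp (\<theta> * ?G x)) \<le> (\<Sum>\<pi>\<in>?P. ennreal (exp (\<theta> * (\<Sum>p\<in>set \<pi>. X p x))))"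
      using member_le_sum[OF \<open>\<pi> \<in> ?P\<close> _ fin, of "\<lambda>\<pi>. ennreal (exp (\<theta> * (\<Sum>p\<in>set \<pi>. X p x)))"] by simp
  qed
  also have "\<dots> = (\<Sum>\<pi>\<in>?P. \<integral>\<^sup>+x. ennreal (exp (\<theta> * (\<Sum>p\<in>set \<pi>. X p x))) \<partial>M)"
  proof (rule nn_integral_sum)
    fix \<pi> assume "\<pi> \<in> ?P"
    then have [measurable]: "X p \<in> borel_measurable M" if "p \<in> set \<pi>" for p
      using up_right_path_in_grid that rv by blast
    show "(\<lambda>x. ennreal (exp (\<theta> * (\<Sum>p\<in>set \<pi>. X p x)))) \<in> borel_measurable M" by measurable
  qed
  also have "\<dots> = (\<Sum>\<pi>\<in>?P. ennreal (\<Prod>p\<in>set \<pi>. r p / (r p - \<theta>)))"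
  proof (intro sum.cong refl nn_integral_exp_sum_exponential[OF indep])
    fix \<pi> p assume "\<pi> \<in> ?P" "p \<in> set \<pi>"
    then have "p \<in> {1..m} \<times> {1..n}" using up_right_path_in_grid by blast
    then show "distributed M lborel (X p) (\<lambda>x. ennreal (exponential_density (r p) x))"
      and "0 < r p \<and> \<theta> < r p" by (rule dist, rule r_pos)
  qed (simp_all only: finite_set up_right_path_in_grid)
  also have "\<dots> = ennreal (\<Sum>\<pi>\<in>?P. \<Prod>p\<in>set \<pi>. r p / (r p - \<theta>))"
  proof (intro sum_ennreal prod_nonneg divide_nonneg_nonneg)
    fix \<pi> p assume "\<pi> \<in> ?P" "p \<in> set \<pi>"
    then have "p \<in> {1..m} \<times> {1..n}" using up_right_path_in_grid by blast
    then show "0 \<le> r p" "0 \<le> r p - \<theta>" using r_pos[of p] by auto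
  qed
  also have "\<dots> \<le> ennreal ((\<Prod>i=1..m. \<rho> i / (\<rho> i - \<theta>) / (1 - \<gamma>)) * (2 / \<gamma>) ^ n)"
  proof (intro ennreal_leI sum_prod_up_right_paths_le \<gamma>)
    fix i j assume ij: "i \<in> {1..m}" "j \<in> {1..n}"
    then show "0 \<le> r (i, j) / (r (i, j) - \<theta>) \<and> r (i, j) / (r (i, j) - \<theta>) \<le> \<rho> i / (\<rho> i - \<theta>)"
      using r[of i j] \<rho>[of i] \<theta> by (auto simp: field_simps)
  next
    fix i assume "i \<in> {1..m}"
    then show "0 \<le> \<rho> i / (\<rho> i - \<theta>) \<and> \<rho> i / (\<rho> i - \<theta>) \<le> 2"
      using \<rho>[of i] \<theta> by (auto simp: field_simps)
  qed simp
  finally have mgf: "(\<integral>\<^sup>+x. ennreal (exp (\<theta> * ?G x)) \<partial>M)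
      \<le> ennreal ((\<Prod>i=1..m. \<rho> i / (\<rho> i - \<theta>) / (1 - \<gamma>)) * (2 / \<gamma>) ^ n)" .
  have "{x \<in> space M. s \<le> ?G x} = {x \<in> space M. \<theta> * s \<le> \<theta> * ?G x}" using \<theta> by simp
  also have "emeasure M \<dots> \<le> ennreal (exp (- (\<theta> * s))) * (\<integral>\<^sup>+x. ennreal (exp (\<theta> * ?G x)) \<partial>M)"
    by (intro chernoff_bound borel_measurable_last_passage rv)
  also have "\<dots> \<le> ennreal (exp (- (\<theta> * s)))
      * ennreal ((\<Prod>i=1..m. \<rho> i / (\<rho> i - \<theta>) / (1 - \<gamma>)) * (2 / \<gamma>) ^ n)"
    by (intro mult_left_mono mgf) simp
  finally show ?thesis by (simp add: ennreal_mult' flip: ennreal_mult')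
qed

text \<open>
  Already the path that crosses all columns in row \<open>j\<close> is unlikely to be this short. Its vertices
  outside the row contribute factors of at most \<open>1\<close> to the Laplace transform, as the weights are
  almost surely nonnegative.
\<close>
lemma (in prob_space) last_passage_lower_tail:
  fixes X :: "nat \<times> nat \<Rightarrow> 'a \<Rightarrow> real" and r :: "nat \<times> nat \<Rightarrow> real"
  assumes indep: "indep_vars (\<lambda>_. borel) X ({1..m} \<times> {1..n})"
    and dist: "\<And>p. p \<in> {1..m} \<times> {1..n} \<Longrightarrow>
      distributed M lborel (X p) (\<lambda>x. ennreal (exponential_density (r p) x))"
    and r: "\<And>p. p \<in> {1..m} \<times> {1..n} \<Longrightarrow> 0 < r p"
    and \<theta>: "0 < \<theta>" and mj: "0 < m" "j \<in> {1..n}"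
  shows "emeasure M {x \<in> space M. last_passage (\<lambda>p. X p x) m n \<le> s}
    \<le> ennreal (exp (\<theta> * s) * (\<Prod>i=1..m. r (i, j) / (r (i, j) + \<theta>)))"
proof -
  let ?G = "\<lambda>x. last_passage (\<lambda>p. X p x) m n"
  have rv: "X p \<in> borel_measurable M" if "p \<in> {1..m} \<times> {1..n}" for p
    using distributed_measurable[OF dist[OF that]] by simp
  obtain \<pi> where \<pi>: "\<pi> \<in> up_right_paths m n" and row: "{1..m} \<times> {j} \<subseteq> set \<pi>"
    using up_right_path_through_row[of m j n] mj by auto
  note grid = up_right_path_in_grid[OF \<pi>]
  have le: "(\<Sum>p\<in>set \<pi>. X p x) \<le> ?G x" for x
    unfolding last_passage_conv_sum_set using finite_up_right_paths \<pi> by (intro Max_ge) auto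
  have [measurable]: "?G \<in> borel_measurable M" by (intro borel_measurable_last_passage rv)
  have rvp[measurable]: "X p \<in> borel_measurable M" if "p \<in> set \<pi>" for p using grid that rv by blast
  have sum_rv: "(\<lambda>x. \<Sum>p\<in>set \<pi>. X p x) \<in> borel_measurable M"
    by (intro borel_measurable_sum rvp)
  have "{x \<in> space M. ?G x \<le> s} \<subseteq> {x \<in> space M. - (\<theta> * s) \<le> (- \<theta>) * (\<Sum>p\<in>set \<pi>. X p x)}"
  proof clarsimp
    fix x assume "?G x \<le> s"
    then have "(\<Sum>p\<in>set \<pi>. X p x) \<le> s" using le[of x] by simp
    then show "\<theta> * (\<Sum>p\<in>set \<pi>. X p x) \<le> \<theta> * s" using \<theta> by simp
  qed
  then have "emeasure M {x \<in> space M. ?G x \<le> s}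
      \<le> emeasure M {x \<in> space M. - (\<theta> * s) \<le> (- \<theta>) * (\<Sum>p\<in>set \<pi>. X p x)}"
    by (intro emeasure_mono) measurable
  also have "\<dots> \<le> ennreal (exp (- (- (\<theta> * s)))) * (\<integral>\<^sup>+x. ennreal (exp ((- \<theta>) * (\<Sum>p\<in>set \<pi>. X p x))) \<partial>M)"
    by (rule chernoff_bound[OF sum_rv])
  also have "(\<integral>\<^sup>+x. ennreal (exp ((- \<theta>) * (\<Sum>p\<in>set \<pi>. X p x))) \<partial>M)
      = ennreal (\<Prod>p\<in>set \<pi>. r p / (r p - (- \<theta>)))"
  proof (intro nn_integral_exp_sum_exponential[OF indep] grid)
    fix p assume "p \<in> set \<pi>"
    then have p: "p \<in> {1..m} \<times> {1..n}" using grid by blast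
    then show "distributed M lborel (X p) (\<lambda>x. ennreal (exponential_density (r p) x))" by (rule dist)
    show "0 < r p \<and> - \<theta> < r p" using r[OF p] \<theta> by auto
  qed simp
  also have "\<dots> \<le> ennreal (\<Prod>i=1..m. r (i, j) / (r (i, j) + \<theta>))"
  proof (rule ennreal_leI)
    have pos: "0 < r p" if "p \<in> set \<pi>" for p using grid r that by blast
    have "(\<Prod>p\<in>set \<pi>. r p / (r p - (- \<theta>)))
        = (\<Prod>p\<in>set \<pi> - {1..m} \<times> {j}. r p / (r p + \<theta>)) * (\<Prod>p\<in>{1..m} \<times> {j}. r p / (r p + \<theta>))"
      using prod.subset_diff[OF row] by simp
    also have "\<dots> \<le> 1 * (\<Prod>p\<in>{1..m} \<times> {j}. r p / (r p + \<theta>))"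
    proof (intro mult_right_mono prod_le_1 prod_nonneg)
      fix p assume "p \<in> {1..m} \<times> {j}"
      then show "0 \<le> r p / (r p + \<theta>)" using pos[of p] row \<theta> by (auto simp: subset_iff)
    next
      fix p assume "p \<in> set \<pi> - {1..m} \<times> {j}"
      then show "0 \<le> r p / (r p + \<theta>) \<and> r p / (r p + \<theta>) \<le> 1" using pos[of p] \<theta> by auto
    qed
    also have "(\<Prod>p\<in>{1..m} \<times> {j}. r p / (r p + \<theta>)) = (\<Prod>i=1..m. r (i, j) / (r (i, j) + \<theta>))"
      by (rule prod.reindex_bij_witness[where i = "\<lambda>i. (i, j)" and j = fst]) auto
    finally show "(\<Prod>p\<in>set \<pi>. r p / (r p - (- \<theta>))) \<le> (\<Prod>i=1..m. r (i, j) / (r (i, j) + \<theta>))"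
      by simp
  qed
  finally show ?thesis by (simp add: ennreal_mult' mult_left_mono)
qed

lemma prod_exponential_mgf_le:
  fixes \<rho> :: "nat \<Rightarrow> real" and \<theta> c :: real
  assumes c: "0 < c" and \<rho>: "\<And>i. i \<in> {1..m} \<Longrightarrow> c \<le> \<rho> i" and \<theta>: "2 * \<bar>\<theta>\<bar> \<le> c"
  shows "(\<Prod>i=1..m. \<rho> i / (\<rho> i - \<theta>)) \<le> exp (\<theta> * (\<Sum>i=1..m. 1 / \<rho> i) + real m * (2 * \<theta>\<^sup>2 / c\<^sup>2))"
proof -
  have "(\<Prod>i=1..m. \<rho> i / (\<rho> i - \<theta>)) \<le> (\<Prod>i=1..m. exp (\<theta> / \<rho> i + 2 * \<theta>\<^sup>2 / c\<^sup>2))"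
  proof (intro prod_mono conjI)
    fix i assume "i \<in> {1..m}"
    then have i: "c \<le> \<rho> i" by (rule \<rho>)
    show "0 \<le> \<rho> i / (\<rho> i - \<theta>)" using i c \<theta> by (intro divide_nonneg_nonneg) auto
    have "\<rho> i / (\<rho> i - \<theta>) \<le> exp (\<theta> / \<rho> i + 2 * (\<theta> / \<rho> i)\<^sup>2)"
      using i c \<theta> by (intro exponential_mgf_le) auto
    also have "(\<theta> / \<rho> i)\<^sup>2 \<le> \<theta>\<^sup>2 / c\<^sup>2"
      unfolding power_divide using i c by (intro divide_left_mono power_mono) auto
    finally show "\<rho> i / (\<rho> i - \<theta>) \<le> exp (\<theta> / \<rho> i + 2 * \<theta>\<^sup>2 / c\<^sup>2)" by simp
  qed
  also have "\<dots> = exp (\<theta> * (\<Sum>i=1..m. 1 / \<rho> i) + real m * (2 * \<theta>\<^sup>2 / c\<^sup>2))"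
    by (simp add: exp_sum[symmetric] sum.distrib sum_distrib_left)
  finally show ?thesis .
qed

text \<open>
  A deviation by \<open>\<eta> * m\<close> gains \<open>\<theta> * \<eta> * m\<close> in the exponent. It is split into four quarters: three
  pay for the quadratic error in the moment generating functions (this bounds \<open>\<theta>\<close>), for the column
  factors \<open>1 / (1 - \<gamma>)\<close> of the path count (this fixes \<open>\<gamma> = 1 - exp (- \<theta> * \<eta> / 4)\<close>) and for its
  row factors \<open>2 / \<gamma>\<close> (this bounds \<open>n / m\<close>); the last quarter is left as the rate of decay.
\<close>
lemma (in prob_space) last_passage_deviation:
  fixes X :: "nat \<times> nat \<Rightarrow> 'a \<Rightarrow> real" and r :: "nat \<times> nat \<Rightarrow> real" and \<rho> :: "nat \<Rightarrow> real"
  assumes indep: "indep_vars (\<lambda>_. borel) X ({1..m} \<times> {1..n})"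
    and dist: "\<And>p. p \<in> {1..m} \<times> {1..n} \<Longrightarrow>
      distributed M lborel (X p) (\<lambda>x. ennreal (exponential_density (r p) x))"
    and r: "\<And>i j. i \<in> {1..m} \<Longrightarrow> j \<in> {1..n} \<Longrightarrow> \<rho> i \<le> r (i, j)"
    and j0: "j0 \<in> {1..n}" "\<And>i. i \<in> {1..m} \<Longrightarrow> r (i, j0) = \<rho> i"
    and \<rho>: "\<And>i. i \<in> {1..m} \<Longrightarrow> c \<le> \<rho> i" and c: "0 < c"
    and \<theta>: "0 < \<theta>" "2 * \<theta> \<le> c" "8 * \<theta> \<le> \<eta> * c\<^sup>2"
    and \<eta>: "0 < \<eta>"
    and m: "0 < m" and n: "real n * ln (2 / (1 - exp (- (\<theta> * \<eta> / 4)))) \<le> \<theta> * \<eta> / 4 * real m"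
  shows "emeasure M {x \<in> space M. \<eta> * real m < \<bar>last_passage (\<lambda>p. X p x) m n - (\<Sum>i=1..m. 1 / \<rho> i)\<bar>}
    \<le> ennreal (2 * exp (- (\<theta> * \<eta> / 4 * real m)))"
proof -
  let ?G = "\<lambda>x. last_passage (\<lambda>p. X p x) m n"
  define s where "s = (\<Sum>i=1..m. 1 / \<rho> i)"
  define k where "k = \<theta> * \<eta> / 4"
  define \<gamma> where "\<gamma> = 1 - exp (- k)"
  have k: "0 < k" using \<theta> \<eta> by (simp add: k_def)
  have \<gamma>: "0 < \<gamma>" "\<gamma> < 1" using k by (auto simp: \<gamma>_def)
  have rv: "X p \<in> borel_measurable M" if "p \<in> {1..m} \<times> {1..n}" for p
    using distributed_measurable[OF dist[OF that]] by simp
  have [measurable]: "?G \<in> borel_measurable M" by (intro borel_measurable_last_passage rv)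
  have n0: "0 < n" using j0 by auto
  have "\<theta> * (8 * \<theta>) \<le> \<theta> * (\<eta> * c\<^sup>2)" using \<theta> by (intro mult_left_mono) auto
  then have quad: "2 * \<theta>\<^sup>2 / c\<^sup>2 \<le> k" using c by (simp add: k_def field_simps power2_eq_square)
  then have quad_m: "real m * (2 * \<theta>\<^sup>2 / c\<^sup>2) \<le> real m * k" by (intro mult_left_mono) auto
  have up: "emeasure M {x \<in> space M. s + \<eta> * real m \<le> ?G x} \<le> ennreal (exp (- (k * real m)))"
  proof -
    have "emeasure M {x \<in> space M. s + \<eta> * real m \<le> ?G x}
      \<le> ennreal (exp (- (\<theta> * (s + \<eta> * real m))) *
          ((\<Prod>i=1..m. \<rho> i / (\<rho> i - \<theta>) / (1 - \<gamma>)) * (2 / \<gamma>) ^ n))"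
    proof (rule last_passage_upper_tail[OF indep dist r _ \<theta>(1) \<gamma> m n0])
      show "2 * \<theta> \<le> \<rho> i" if "i \<in> {1..m}" for i using \<rho>[OF that] \<theta> by simp
    qed auto
    also have "(\<Prod>i=1..m. \<rho> i / (\<rho> i - \<theta>) / (1 - \<gamma>))
        = (\<Prod>i=1..m. \<rho> i / (\<rho> i - \<theta>)) * exp (k * real m)"
    proof -
      have "(1 - \<gamma>) ^ m = exp (- (k * real m))"
        by (simp add: \<gamma>_def exp_of_nat_mult[symmetric] mult.commute)
      then show ?thesis by (simp add: divide_inverse prod.distrib exp_minus power_inverse)
    qed
    also have "(2 / \<gamma>) ^ n = exp (real n * ln (2 / \<gamma>))"
      using \<gamma> by (simp add: exp_of_nat_mult)
    also have "exp (- (\<theta> * (s + \<eta> * real m))) *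
          ((\<Prod>i=1..m. \<rho> i / (\<rho> i - \<theta>)) * exp (k * real m) * exp (real n * ln (2 / \<gamma>)))
        \<le> exp (- (\<theta> * (s + \<eta> * real m))) *
          (exp (\<theta> * s + real m * k) * exp (k * real m) * exp (k * real m))"
    proof (intro mult_left_mono mult_mono)
      have "(\<Prod>i=1..m. \<rho> i / (\<rho> i - \<theta>)) \<le> exp (\<theta> * s + real m * (2 * \<theta>\<^sup>2 / c\<^sup>2))"
        unfolding s_def using \<theta> by (intro prod_exponential_mgf_le c \<rho>) auto
      also have "\<dots> \<le> exp (\<theta> * s + real m * k)" using quad_m by simp
      finally show "(\<Prod>i=1..m. \<rho> i / (\<rho> i - \<theta>)) \<le> exp (\<theta> * s + real m * k)" .
      show "exp (real n * ln (2 / \<gamma>)) \<le> exp (k * real m)" using n by (simp add: \<gamma>_def k_def)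
    qed auto
    also have "\<dots> = exp (- (k * real m))"
      by (simp add: exp_add[symmetric] k_def algebra_simps)
    finally show ?thesis by (simp add: ennreal_leI)
  qed
  have low: "emeasure M {x \<in> space M. ?G x \<le> s - \<eta> * real m} \<le> ennreal (exp (- (k * real m)))"
  proof -
    have "emeasure M {x \<in> space M. ?G x \<le> s - \<eta> * real m}
      \<le> ennreal (exp (\<theta> * (s - \<eta> * real m)) * (\<Prod>i=1..m. r (i, j0) / (r (i, j0) + \<theta>)))"
    proof (rule last_passage_lower_tail[OF indep dist _ \<theta>(1) m j0(1)])
      fix p assume "p \<in> {1..m} \<times> {1..n}"
      then show "0 < r p" using r[of "fst p" "snd p"] \<rho>[of "fst p"] c by auto
    qed auto
    also have "(\<Prod>i=1..m. r (i, j0) / (r (i, j0) + \<theta>)) = (\<Prod>i=1..m. \<rho> i / (\<rho> i - (- \<theta>)))"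
      using j0(2) by (intro prod.cong) auto
    also have "exp (\<theta> * (s - \<eta> * real m)) * \<dots> \<le> exp (\<theta> * (s - \<eta> * real m)) * exp ((- \<theta>) * s + real m * k)"
    proof (intro mult_left_mono)
      have "(\<Prod>i=1..m. \<rho> i / (\<rho> i - (- \<theta>))) \<le> exp ((- \<theta>) * s + real m * (2 * (- \<theta>)\<^sup>2 / c\<^sup>2))"
        unfolding s_def using \<theta> by (intro prod_exponential_mgf_le c \<rho>) auto
      also have "\<dots> \<le> exp ((- \<theta>) * s + real m * k)" using quad_m by simp
      finally show "(\<Prod>i=1..m. \<rho> i / (\<rho> i - (- \<theta>))) \<le> exp ((- \<theta>) * s + real m * k)" .
    qed simp
    also have "\<dots> = exp (- (3 * (k * real m)))"
      by (simp add: exp_add[symmetric] k_def algebra_simps)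
    also have "\<dots> \<le> exp (- (k * real m))" using k by simp
    finally show ?thesis by (simp add: ennreal_leI)
  qed
  have "emeasure M {x \<in> space M. \<eta> * real m < \<bar>?G x - s\<bar>}
      \<le> emeasure M ({x \<in> space M. s + \<eta> * real m \<le> ?G x} \<union> {x \<in> space M. ?G x \<le> s - \<eta> * real m})"
    by (intro emeasure_mono) (auto simp: abs_if split: if_splits)
  also have "\<dots> \<le> emeasure M {x \<in> space M. s + \<eta> * real m \<le> ?G x}
      + emeasure M {x \<in> space M. ?G x \<le> s - \<eta> * real m}"
    by (intro emeasure_subadditive) measurable
  also have "\<dots> \<le> ennreal (exp (- (k * real m))) + ennreal (exp (- (k * real m)))"
    by (intro add_mono up low)
  also have "\<dots> = ennreal (2 * exp (- (k * real m)))"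
    by (simp add: ennreal_plus[symmetric] del: ennreal_plus)
  finally show ?thesis by (simp add: s_def k_def)
qed

section \<open>Empirical means\<close>

lemma integral_empirical:
  assumes "0 < m" and "f \<in> borel_measurable borel"
  shows "integral\<^sup>L (empirical a m) f = (\<Sum>i=1..m. f (a m i)) / real m"
  unfolding empirical_def using assms
  by (subst integral_distr) (auto simp: integral_uniform_count_measure measurable_def
      sets_uniform_count_measure space_uniform_count_measure)

lemma tendsto_inverse_distance_at_infinity: "((\<lambda>x::real. 1 / (\<bar>x - z\<bar> + d)) \<longlongrightarrow> 0) at_infinity"
proof -
  have "filterlim (\<lambda>x. (d - norm z) + norm x) at_top (at_infinity :: real filter)"
    by (intro filterlim_tendsto_add_at_top[OF tendsto_const] filterlim_norm_at_top)
  then have "filterlim (\<lambda>x::real. \<bar>x - z\<bar> + d) at_top at_infinity"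
    by (rule filterlim_at_top_mono) (auto intro!: always_eventually)
  then have "((\<lambda>x::real. inverse (\<bar>x - z\<bar> + d)) \<longlongrightarrow> 0) at_infinity"
    by (intro tendsto_inverse_0_at_top)
  then show ?thesis by (simp add: divide_inverse)
qed

text \<open>
  A test function that is positive exactly on \<open>x < A\<close> has integral zero along the sequence, hence
  also in the limit. It has to be damped as \<open>x\<close> tends to minus infinity, since vague convergence
  sees only functions that vanish there.
\<close>
lemma vague_limit_AE_ge:
  assumes sets: "sets \<alpha> = sets borel" and fin: "finite_measure \<alpha>"
    and conv: "vague_conv (empirical a) \<alpha>"
    and ge: "\<And>m i. 0 < m \<Longrightarrow> i \<in> {1..m} \<Longrightarrow> A \<le> a m i"
  shows "AE x in \<alpha>. A \<le> x"
proof -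
  interpret finite_measure \<alpha> by (rule fin)
  define \<psi> :: "real \<Rightarrow> real" where "\<psi> x = min 1 (max 0 (A - x)) * (1 / (\<bar>x - A\<bar> + 1))" for x
  have cont: "continuous_on UNIV \<psi>" unfolding \<psi>_def by (intro continuous_intros) auto
  then have meas: "\<psi> \<in> borel_measurable borel" by (rule borel_measurable_continuous_onI)
  have "(\<psi> \<longlongrightarrow> 0) at_infinity"
  proof (rule tendsto_sandwich[OF _ _ tendsto_const tendsto_inverse_distance_at_infinity])
    show "\<forall>\<^sub>F x in at_infinity. \<psi> x \<le> 1 / (\<bar>x - A\<bar> + 1)"
      unfolding \<psi>_def by (intro always_eventually allI mult_left_le_one_le) auto
  qed (auto simp: \<psi>_def)
  then have lim: "(\<lambda>m. integral\<^sup>L (empirical a m) \<psi>) \<longlonglongrightarrow> integral\<^sup>L \<alpha> \<psi>"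
    using conv cont by (auto simp: vague_conv_def)
  have "\<forall>\<^sub>F m in sequentially. integral\<^sup>L (empirical a m) \<psi> = 0"
    using eventually_gt_at_top[of "0::nat"]
  proof eventually_elim
    case (elim m)
    then show ?case using ge[of m] by (auto simp: integral_empirical meas \<psi>_def intro!: sum.neutral)
  qed
  from LIMSEQ_unique[OF lim tendsto_eventually[OF this]] have int0: "integral\<^sup>L \<alpha> \<psi> = 0" .
  have nonneg: "0 \<le> \<psi> x" for x by (simp add: \<psi>_def)
  have "\<psi> \<in> borel_measurable \<alpha>" using meas measurable_cong_sets[OF sets] by blast
  moreover have "\<bar>\<psi> x\<bar> \<le> 1" for x
    using nonneg[of x] unfolding \<psi>_def by (auto intro!: mult_le_one)
  ultimately have "integrable \<alpha> \<psi>" by (intro integrable_const_bound[of _ 1]) auto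
  then have "AE x in \<alpha>. \<psi> x = 0"
    using integral_nonneg_eq_0_iff_AE[of \<alpha> \<psi>] nonneg int0 by auto
  then show ?thesis
  proof eventually_elim
    case (elim x)
    then show ?case by (auto simp: \<psi>_def min_def max_def split: if_splits)
  qed
qed

text \<open>
  The functions \<open>1 / (x + t)\<close> are Lipschitz in \<open>t\<close> and small for large \<open>t\<close>, uniformly in \<open>x\<close>, so
  finitely many values of \<open>t\<close> represent all of them up to a small error in the supremum norm.
  Subprobability measures do not increase this error, and at each of the finitely many values
  vague convergence applies. To apply it, \<open>1 / (x + t)\<close> is extended from \<open>x \<ge> A\<close>, where all the
  measures live, to the line by reflection at \<open>A\<close>; the extension is continuous and vanishes at
  infinity.
\<close>
lemma uniform_convergence_reciprocal_mean:
  assumes sets: "sets \<alpha> = sets borel" and sub: "subprob_space \<alpha>"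
    and conv: "vague_conv (empirical a) \<alpha>"
    and ge: "\<And>m i. 0 < m \<Longrightarrow> i \<in> {1..m} \<Longrightarrow> A \<le> a m i"
    and pos: "0 < A + B" and \<epsilon>: "0 < \<epsilon>"
  shows "\<forall>\<^sub>F m in sequentially. \<forall>t\<ge>B.
    \<bar>(\<Sum>i=1..m. 1 / (a m i + t)) / real m - (\<integral>x. 1 / (x + t) \<partial>\<alpha>)\<bar> \<le> \<epsilon>"
proof -
  interpret subprob_space \<alpha> by (rule sub)
  define c where "c = A + B"
  define \<phi> :: "real \<Rightarrow> real \<Rightarrow> real" where "\<phi> t x = 1 / (\<bar>x - A\<bar> + (A + t))" for t x
  define \<eta> where "\<eta> = \<epsilon> / 3"
  have c: "0 < c" and \<eta>: "0 < \<eta>" using pos \<epsilon> by (auto simp: c_def \<eta>_def)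
  have den: "c \<le> \<bar>x - A\<bar> + (A + t)" if "B \<le> t" for x t using that by (simp add: c_def)
  have cont: "continuous_on UNIV (\<phi> t)" if "B \<le> t" for t
    unfolding \<phi>_def using den[OF that] c by (intro continuous_intros) (auto, smt (verit))
  have vanishing: "(\<phi> t \<longlongrightarrow> 0) at_infinity" for t
    using tendsto_inverse_distance_at_infinity[of A "A + t"] by (simp add: \<phi>_def[abs_def])
  have meas: "\<phi> t \<in> borel_measurable borel" if "B \<le> t" for t
    using cont[OF that] by (rule borel_measurable_continuous_onI)
  have meas\<alpha>: "\<phi> t \<in> borel_measurable \<alpha>" if "B \<le> t" for t
    using meas[OF that] measurable_cong_sets[OF sets] by blast
  have bound: "0 \<le> \<phi> t x" "\<phi> t x \<le> 1 / c" "\<phi> t x \<le> 1 / (A + t)" if "B \<le> t" for t x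
    unfolding \<phi>_def using den[OF that, of x] c that pos by (auto intro!: divide_left_mono mult_pos_pos)
  have integrable: "integrable \<alpha> (\<phi> t)" if "B \<le> t" for t
    using bound[OF that] meas\<alpha>[OF that] by (intro integrable_const_bound[of _ "1 / c"]) auto
  have mean: "(\<Sum>i=1..m. 1 / (a m i + t)) / real m = (\<Sum>i=1..m. \<phi> t (a m i)) / real m" if "0 < m" for t m
    using ge[OF that] by (intro arg_cong2[where f = "(/)"] sum.cong refl) (auto simp: \<phi>_def)
  have int: "(\<integral>x. 1 / (x + t) \<partial>\<alpha>) = integral\<^sup>L \<alpha> (\<phi> t)" if "B \<le> t" for t
  proof (rule integral_cong_AE)
    show "AE x in \<alpha>. 1 / (x + t) = \<phi> t x"
      using vague_limit_AE_ge[OF sets finite_measure_axioms conv ge] by (auto simp: \<phi>_def)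
    have "(\<lambda>x. 1 / (x + t)) \<in> borel_measurable borel" by measurable
    then show "(\<lambda>x. 1 / (x + t)) \<in> borel_measurable \<alpha>" using measurable_cong_sets[OF sets] by blast
  qed (rule meas\<alpha>[OF that])
  have lip: "\<bar>\<phi> s x - \<phi> t x\<bar> \<le> \<bar>s - t\<bar> / c\<^sup>2" if "B \<le> s" "B \<le> t" for s t x
  proof -
    let ?p = "\<bar>x - A\<bar> + (A + s)" and ?q = "\<bar>x - A\<bar> + (A + t)"
    have d: "c \<le> ?p" "c \<le> ?q" using den that by auto
    then have "\<phi> s x - \<phi> t x = (t - s) / (?p * ?q)" using c by (simp add: \<phi>_def field_simps)
    then have "\<bar>\<phi> s x - \<phi> t x\<bar> = \<bar>s - t\<bar> / (?p * ?q)"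
      using d c by (simp add: abs_mult abs_minus_commute)
    also have "\<dots> \<le> \<bar>s - t\<bar> / c\<^sup>2"
      unfolding power2_eq_square using d c by (intro divide_left_mono mult_mono mult_pos_pos) auto
    finally show ?thesis .
  qed
  define h where "h = \<eta> * c\<^sup>2"
  have h: "0 < h" using \<eta> c by (simp add: h_def)
  obtain N :: nat where N: "1 / \<eta> / h < real N" using reals_Archimedean2 by blast
  \<comment> \<open>A mesh \<open>h\<close> costs \<open>h / c\<^sup>2 = \<eta>\<close>; beyond \<open>T N\<close> all the functions lie between \<open>0\<close> and \<open>\<eta>\<close>.\<close>
  define T where "T k = B + real k * h" for k :: nat
  have T_ge: "B \<le> T k" for k using h by (simp add: T_def)
  have net: "\<exists>k\<le>N. \<forall>x. \<bar>\<phi> t x - \<phi> (T k) x\<bar> \<le> \<eta>" if t: "B \<le> t" for t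
  proof (cases "T N \<le> t")
    case True
    have "1 / \<eta> < real N * h" using N unfolding pos_divide_less_eq[OF h] .
    then have "1 / \<eta> < A + T N" using c by (simp add: T_def c_def)
    then have "1 < (A + T N) * \<eta>" unfolding pos_divide_less_eq[OF \<eta>] .
    moreover have "0 < A + T N" using T_ge[of N] c by (simp add: c_def)
    ultimately have small: "1 / (A + T N) \<le> \<eta>" by (simp add: pos_divide_le_eq mult.commute)
    have "\<bar>\<phi> t x - \<phi> (T N) x\<bar> \<le> \<eta>" for x
    proof -
      have "\<phi> t x \<le> 1 / (A + t)" by (rule bound[OF t])
      also have "\<dots> \<le> 1 / (A + T N)"
        using True T_ge[of N] c by (intro divide_left_mono mult_pos_pos) (auto simp: c_def)
      finally show ?thesis using bound[OF t, of x] bound[OF T_ge, of N x] small by linarith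
    qed
    then show ?thesis by blast
  next
    case False
    define k where "k = nat \<lfloor>(t - B) / h\<rfloor>"
    have "0 \<le> (t - B) / h" using t h by simp
    then have "real k \<le> (t - B) / h" "(t - B) / h < real k + 1" by (auto simp: k_def)
    then have k: "real k * h \<le> t - B" "t - B < real k * h + h" using h by (auto simp: field_simps)
    have "real k * h < real N * h" using k False unfolding T_def by linarith
    then have "k \<le> N" using h by simp
    moreover have "\<bar>\<phi> t x - \<phi> (T k) x\<bar> \<le> \<eta>" for x
    proof -
      have "\<bar>\<phi> t x - \<phi> (T k) x\<bar> \<le> \<bar>t - T k\<bar> / c\<^sup>2" by (rule lip[OF t T_ge])
      also have "\<dots> \<le> h / c\<^sup>2" using k by (intro divide_right_mono) (auto simp: T_def)
      also have "\<dots> = \<eta>" using c by (simp add: h_def)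
      finally show ?thesis .
    qed
    ultimately show ?thesis by blast
  qed
  have "\<forall>\<^sub>F m in sequentially. \<forall>k\<in>{..N}. \<bar>(\<Sum>i=1..m. \<phi> (T k) (a m i)) / real m - integral\<^sup>L \<alpha> (\<phi> (T k))\<bar> < \<eta>"
  proof (rule eventually_ball_finite, simp, intro ballI)
    fix k
    have "(\<lambda>m. integral\<^sup>L (empirical a m) (\<phi> (T k))) \<longlonglongrightarrow> integral\<^sup>L \<alpha> (\<phi> (T k))"
      using conv cont[OF T_ge] vanishing by (simp add: vague_conv_def)
    then have "\<forall>\<^sub>F m in sequentially. \<bar>integral\<^sup>L (empirical a m) (\<phi> (T k)) - integral\<^sup>L \<alpha> (\<phi> (T k))\<bar> < \<eta>"
      using \<eta> by (auto simp: tendsto_iff dist_real_def)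
    then show "\<forall>\<^sub>F m in sequentially. \<bar>(\<Sum>i=1..m. \<phi> (T k) (a m i)) / real m - integral\<^sup>L \<alpha> (\<phi> (T k))\<bar> < \<eta>"
      using eventually_gt_at_top[of "0::nat"]
      by eventually_elim (simp add: integral_empirical meas[OF T_ge])
  qed
  then show ?thesis
    using eventually_gt_at_top[of "0::nat"]
  proof eventually_elim
    case (elim m)
    show ?case
    proof (intro allI impI)
      fix t assume t: "B \<le> t"
      obtain k where k: "k \<le> N" "\<And>x. \<bar>\<phi> t x - \<phi> (T k) x\<bar> \<le> \<eta>" using net[OF t] by blast
      let ?S = "\<lambda>t. (\<Sum>i=1..m. \<phi> t (a m i)) / real m"
      have "\<bar>\<Sum>i=1..m. \<phi> t (a m i) - \<phi> (T k) (a m i)\<bar> \<le> (\<Sum>i=1..m. \<eta>)"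
        by (rule order_trans[OF sum_abs]) (intro sum_mono k)
      then have 1: "\<bar>?S t - ?S (T k)\<bar> \<le> \<eta>"
        using elim by (simp add: sum_subtractf diff_divide_distrib[symmetric] pos_divide_le_eq mult.commute)
      have 2: "\<bar>?S (T k) - integral\<^sup>L \<alpha> (\<phi> (T k))\<bar> < \<eta>" using elim k by auto
      have "\<bar>integral\<^sup>L \<alpha> (\<phi> t) - integral\<^sup>L \<alpha> (\<phi> (T k))\<bar> = \<bar>\<integral>x. \<phi> t x - \<phi> (T k) x \<partial>\<alpha>\<bar>"
        by (simp add: integrable t T_ge)
      also have "\<dots> \<le> (\<integral>x. \<bar>\<phi> t x - \<phi> (T k) x\<bar> \<partial>\<alpha>)" by (rule integral_abs_bound)
      also have "\<dots> \<le> (\<integral>x. \<eta> \<partial>\<alpha>)"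
        using k(2) integrable t T_ge by (intro integral_mono integrable_abs Bochner_Integration.integrable_diff) auto
      also have "\<dots> \<le> \<eta>" using subprob_measure_le_1[of "space \<alpha>"] \<eta> by (simp add: mult_left_le_one_le)
      finally have 3: "\<bar>integral\<^sup>L \<alpha> (\<phi> t) - integral\<^sup>L \<alpha> (\<phi> (T k))\<bar> \<le> \<eta>" .
      show "\<bar>(\<Sum>i=1..m. 1 / (a m i + t)) / real m - (\<integral>x. 1 / (x + t) \<partial>\<alpha>)\<bar> \<le> \<epsilon>"
        using 1 2 3 elim(2) unfolding mean[OF elim(2)] int[OF t] \<eta>_def by linarith
    qed
  qed
qed

section \<open>The shape theorem near an axis\<close>

lemma row_min_le:
  assumes "i \<in> {1..m}"
  shows "row_min a m \<le> a m i"
  unfolding row_min_def using assms by (intro Min_le) auto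

lemma row_min_attained:
  assumes "0 < m"
  shows "\<exists>i\<in>{1..m}. a m i = row_min a m"
proof -
  have "Min (a m ` {1..m}) \<in> a m ` {1..m}" using assms by (intro Min_in) auto
  then show ?thesis by (force simp: row_min_def)
qed

text \<open>
  In the extended reals a sum with a summand \<open>\<infinity>\<close> is \<open>\<infinity>\<close> whatever the other one is, so positivity
  is informative only if both index sets are nonempty.
\<close>
lemma inf_row_min_add_pos:
  assumes pos: "0 < inf_row_min a R + inf_row_min b S" and ne: "R \<noteq> {}" "S \<noteq> {}"
  obtains A B where "\<And>m. m \<in> R \<Longrightarrow> A \<le> row_min a m" "\<And>n. n \<in> S \<Longrightarrow> B \<le> row_min b n" "0 < A + B"
proof -
  have le: "inf_row_min a T \<le> ereal (row_min a m)" if "m \<in> T" for a T m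
    unfolding inf_row_min_def using that by (rule INF_lower)
  obtain m0 n0 where "m0 \<in> R" "n0 \<in> S" using ne by blast
  then have "inf_row_min a R \<noteq> \<infinity>" "inf_row_min b S \<noteq> \<infinity>"
    using le[of m0 R a] le[of n0 S b] by auto
  then obtain A B where "inf_row_min a R = ereal A" "inf_row_min b S = ereal B" "0 < A + B"
    using pos by (cases "inf_row_min a R"; cases "inf_row_min b S") auto
  with le[of _ R a] le[of _ S b] show ?thesis by (intro that[of A B]) auto
qed

lemma (in prob_space) indep_vars_reindex:
  assumes indep: "indep_vars M' X I" and inj: "inj_on g K" and sub: "g ` K \<subseteq> I"
  shows "indep_vars (\<lambda>k. M' (g k)) (\<lambda>k. X (g k)) K"
proof -
  let ?F = "\<lambda>i. {X i -` A \<inter> space M |A. A \<in> sets (M' i)}"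
  have rv: "\<And>i. i \<in> I \<Longrightarrow> random_variable (M' i) (X i)" and ind: "indep_sets ?F I"
    using indep by (auto simp: indep_vars_def2)
  have "indep_sets (\<lambda>k. ?F (g k)) K"
  proof (rule indep_setsI)
    fix k assume "k \<in> K"
    then show "?F (g k) \<subseteq> events" using ind sub by (auto simp: indep_sets_def)
  next
    fix A J assume J: "J \<noteq> {}" "J \<subseteq> K" "finite J" and A: "\<forall>j\<in>J. A j \<in> ?F (g j)"
    have injJ: "inj_on g J" using inj J(2) by (rule inj_on_subset)
    define A' where "A' i = A (the_inv_into J g i)" for i
    have A': "A' (g j) = A j" if "j \<in> J" for j using the_inv_into_f_f[OF injJ that] by (simp add: A'_def)
    have "prob (\<Inter>i\<in>g ` J. A' i) = (\<Prod>i\<in>g ` J. prob (A' i))"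
      using J sub A A' by (intro indep_setsD[OF ind]) auto
    then show "prob (\<Inter>j\<in>J. A j) = (\<Prod>j\<in>J. prob (A j))"
      using A' by (simp add: prod.reindex[OF injJ])
  qed
  then show ?thesis using rv sub by (auto simp: indep_vars_def2)
qed

text \<open>
  Deviations larger than \<open>\<epsilon> / 2 * m\<close> for a given \<open>m\<close> have probability at most \<open>m\<close> times the
  exponential bound, because \<open>\<delta> \<le> 1\<close> leaves at most \<open>m\<close> values of \<open>n\<close>. The other half of \<open>\<epsilon>\<close> is
  for the deterministic error.
\<close>
theorem (in prob_space) last_passage_shape_near_axis:
  fixes a b :: "nat \<Rightarrow> nat \<Rightarrow> real" and X :: "nat \<Rightarrow> nat \<Rightarrow> nat \<times> nat \<Rightarrow> 'a \<Rightarrow> real"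
  assumes indep: "\<And>m n. 0 < m \<Longrightarrow> n \<in> S \<Longrightarrow> indep_vars (\<lambda>_. borel) (X m n) ({1..m} \<times> {1..n})"
    and dist: "\<And>m n i j. 0 < m \<Longrightarrow> n \<in> S \<Longrightarrow> i \<in> {1..m} \<Longrightarrow> j \<in> {1..n} \<Longrightarrow>
      distributed M lborel (X m n (i, j)) (\<lambda>x. ennreal (exponential_density (a m i + b n j) x))"
    and S: "S \<subseteq> {0<..}" and \<epsilon>: "0 < \<epsilon>"
    and \<alpha>: "subprob_space \<alpha>" "sets \<alpha> = sets borel" "vague_conv (empirical a) \<alpha>"
    and inf: "0 < inf_row_min a {1..} + inf_row_min b S"
  shows "\<exists>\<delta>>0. AE x in M. \<exists>K>0. \<forall>m\<ge>K. \<forall>n\<in>S. real n \<le> \<delta> * real m \<longrightarrow>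
    \<bar>last_passage (\<lambda>p. X m n p x) m n - real m * (\<integral>t. 1 / (t + row_min b n) \<partial>\<alpha>)\<bar> \<le> \<epsilon> * real m"
proof (cases "S = {}")
  case True
  then show ?thesis by (intro exI[of _ 1]) auto
next
  case False
  obtain A B where A': "\<And>m. m \<in> {1..} \<Longrightarrow> A \<le> row_min a m" and B: "\<And>n. n \<in> S \<Longrightarrow> B \<le> row_min b n"
    and AB: "0 < A + B"
    using inf_row_min_add_pos[OF inf _ False] by auto
  have A: "A \<le> a m i" if "0 < m" "i \<in> {1..m}" for m i
    using A'[of m] row_min_le[of i m a] that by simp
  define c where "c = A + B"
  define \<eta> where "\<eta> = \<epsilon> / 2"
  define \<theta> where "\<theta> = min (c / 2) (\<eta> * c\<^sup>2 / 8)"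
  define k where "k = \<theta> * \<eta> / 4"
  define L where "L = ln (2 / (1 - exp (- k)))"
  define \<delta> where "\<delta> = min 1 (k / L)"
  have c: "0 < c" and \<eta>: "0 < \<eta>" using AB \<epsilon> by (auto simp: c_def \<eta>_def)
  then have \<theta>: "0 < \<theta>" "2 * \<theta> \<le> c" "8 * \<theta> \<le> \<eta> * c\<^sup>2" by (auto simp: \<theta>_def min_def)
  have k: "0 < k" using \<theta> \<eta> by (simp add: k_def)
  have L: "0 < L"
  proof -
    have "exp (- k) < 1" using k by simp
    then have "0 < 1 - exp (- k)" "1 - exp (- k) < 2" using exp_gt_zero[of "- k"] by linarith+
    then show ?thesis by (simp add: L_def)
  qed
  have \<delta>: "0 < \<delta>" using k L by (simp add: \<delta>_def)
  let ?G = "\<lambda>m n x. last_passage (\<lambda>p. X m n p x) m n"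
  let ?s = "\<lambda>m n. \<Sum>i=1..m. 1 / (a m i + row_min b n)"
  define N where "N m = {n \<in> S. real n \<le> \<delta> * real m}" for m
  define dev where "dev m n = {x \<in> space M. \<eta> * real m < \<bar>?G m n x - ?s m n\<bar>}" for m n
  define bad where "bad m = (\<Union>n\<in>N m. dev m n)" for m
  have N: "N m \<subseteq> {1..m}" for m
  proof
    fix n assume "n \<in> N m"
    then have n: "n \<in> S" "real n \<le> \<delta> * real m" by (auto simp: N_def)
    have "\<delta> * real m \<le> 1 * real m" by (intro mult_right_mono) (auto simp: \<delta>_def)
    with n S show "n \<in> {1..m}" by auto
  qed
  then have finN: "finite (N m)" and cardN: "card (N m) \<le> m" for m
    using finite_subset[OF N[of m]] card_mono[OF _ N[of m]] by auto
  have dev_sets: "dev m n \<in> sets M" if "n \<in> N m" for m n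
  proof -
    have m: "0 < m" and n: "n \<in> S" using N[of m] that by (auto simp: N_def)
    have "?G m n \<in> borel_measurable M"
    proof (rule borel_measurable_last_passage)
      fix p assume "p \<in> {1..m} \<times> {1..n}"
      then show "X m n p \<in> borel_measurable M"
        using distributed_measurable[OF dist[OF m n, of "fst p" "snd p"]] by auto
    qed
    then show ?thesis unfolding dev_def by measurable
  qed
  have dev_le: "emeasure M (dev m n) \<le> ennreal (2 * exp (- (k * real m)))" if "n \<in> N m" for m n
  proof -
    have m: "0 < m" and n: "n \<in> S" "0 < n" "real n \<le> \<delta> * real m" using N[of m] that by (auto simp: N_def)
    have nL: "real n * L \<le> k * real m"
    proof -
      have "real n * L \<le> \<delta> * real m * L" using n L by (intro mult_right_mono) auto
      also have "\<dots> \<le> k / L * real m * L" using L by (intro mult_right_mono) (auto simp: \<delta>_def)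
      also have "\<dots> = k * real m" using L by simp
      finally show ?thesis .
    qed
    obtain j0 where j0: "j0 \<in> {1..n}" "b n j0 = row_min b n" using row_min_attained[OF n(2)] by blast
    show ?thesis
      unfolding dev_def k_def
    proof (rule last_passage_deviation[OF indep[OF m n(1)], where c = c and ?j0.0 = j0
          and r = "\<lambda>p. a m (fst p) + b n (snd p)" and \<rho> = "\<lambda>i. a m i + row_min b n"])
      show "c \<le> a m i + row_min b n" if "i \<in> {1..m}" for i
        using A[OF m that] B[OF n(1)] by (simp add: c_def)
      show "real n * ln (2 / (1 - exp (- (\<theta> * \<eta> / 4)))) \<le> \<theta> * \<eta> / 4 * real m"
        using nL by (simp add: L_def k_def)
    qed (use dist[OF m n(1)] j0 row_min_le[of _ n b] c \<theta> \<eta> m in auto)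
  qed
  have bad_sets: "bad m \<in> sets M" for m
    unfolding bad_def using finN dev_sets by (intro sets.finite_UN) auto
  have bad_le: "measure M (bad m) \<le> real m * (2 * exp (- (k * real m)))" for m
  proof -
    have "measure M (dev m n) \<le> 2 * exp (- (k * real m))" if "n \<in> N m" for n
      using dev_le[OF that] by (simp add: emeasure_eq_measure)
    then have "(\<Sum>n\<in>N m. measure M (dev m n)) \<le> real (card (N m)) * (2 * exp (- (k * real m)))"
      by (intro sum_bounded_above)
    also have "\<dots> \<le> real m * (2 * exp (- (k * real m)))" using cardN by (intro mult_right_mono) auto
    finally show ?thesis
      using measure_UNION_le[OF finN, of m "dev m" M] dev_sets by (auto simp: bad_def)
  qed
  have "summable (\<lambda>m. measure M (bad m))"
  proof (rule summable_comparison_test_ev)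
    show "\<forall>\<^sub>F m in sequentially. norm (measure M (bad m)) \<le> 4 / k * exp (- (k / 2)) ^ m"
    proof (intro always_eventually allI)
      fix m
      \<comment> \<open>Half of the rate absorbs the factor \<open>m\<close>.\<close>
      have "real m * exp (- (k * real m)) = 2 / k * (k * real m / 2) * exp (- (k * real m))" using k by simp
      also have "\<dots> \<le> 2 / k * exp (k * real m / 2) * exp (- (k * real m))"
      proof (intro mult_right_mono mult_left_mono)
        show "k * real m / 2 \<le> exp (k * real m / 2)"
          using exp_ge_add_one_self[of "k * real m / 2"] by linarith
      qed (use k in auto)
      also have "\<dots> = 2 / k * exp (- (k / 2)) ^ m"
        unfolding exp_of_nat_mult[symmetric] mult.assoc exp_add[symmetric] by (simp add: field_simps)
      finally show "norm (measure M (bad m)) \<le> 4 / k * exp (- (k / 2)) ^ m"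
        using bad_le[of m] by simp
    qed
    show "summable (\<lambda>m. 4 / k * exp (- (k / 2)) ^ m)"
      using k by (intro summable_mult summable_geometric) auto
  qed
  then have AE: "AE x in M. \<forall>\<^sub>F m in sequentially. x \<in> space M - bad m"
    by (intro borel_cantelli_AE1 bad_sets) (auto simp: emeasure_eq_measure)
  have unif: "\<forall>\<^sub>F m in sequentially. \<forall>t\<ge>B.
      \<bar>(\<Sum>i=1..m. 1 / (a m i + t)) / real m - (\<integral>x. 1 / (x + t) \<partial>\<alpha>)\<bar> \<le> \<eta>"
    by (rule uniform_convergence_reciprocal_mean[OF \<alpha>(2,1,3) A AB \<eta>])
  have "AE x in M. \<exists>K>0. \<forall>m\<ge>K. \<forall>n\<in>S. real n \<le> \<delta> * real m \<longrightarrow>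
      \<bar>?G m n x - real m * (\<integral>t. 1 / (t + row_min b n) \<partial>\<alpha>)\<bar> \<le> \<epsilon> * real m"
    using AE
  proof eventually_elim
    case (elim x)
    have "\<forall>\<^sub>F m in sequentially. \<forall>n\<in>S. real n \<le> \<delta> * real m \<longrightarrow>
      \<bar>?G m n x - real m * (\<integral>t. 1 / (t + row_min b n) \<partial>\<alpha>)\<bar> \<le> \<epsilon> * real m"
      using elim unif eventually_gt_at_top[of "0::nat"]
    proof eventually_elim
      case (elim m)
      show ?case
      proof (intro ballI impI)
        fix n assume n: "n \<in> S" "real n \<le> \<delta> * real m"
        let ?I = "\<integral>t. 1 / (t + row_min b n) \<partial>\<alpha>"
        have 1: "\<bar>?G m n x - ?s m n\<bar> \<le> \<eta> * real m"
          using elim(1) n by (auto simp: bad_def N_def dev_def not_less)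
        have "\<bar>?s m n / real m - ?I\<bar> \<le> \<eta>" using elim(2) B[OF n(1)] by blast
        then have "\<bar>?s m n / real m - ?I\<bar> * real m \<le> \<eta> * real m" by (intro mult_right_mono) auto
        also have "\<bar>?s m n / real m - ?I\<bar> * real m = \<bar>(?s m n / real m - ?I) * real m\<bar>"
          by (simp add: abs_mult)
        also have "(?s m n / real m - ?I) * real m = ?s m n - real m * ?I"
          using elim(3) by (simp add: left_diff_distrib)
        finally have 2: "\<bar>?s m n - real m * ?I\<bar> \<le> \<eta> * real m" .
        have "\<epsilon> * real m = \<eta> * real m + \<eta> * real m" by (simp add: \<eta>_def)
        with 1 2 show "\<bar>?G m n x - real m * ?I\<bar> \<le> \<epsilon> * real m" by linarith
      qed
    qed
    then obtain K where "\<forall>m\<ge>K. \<forall>n\<in>S. real n \<le> \<delta> * real m \<longrightarrow>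
      \<bar>?G m n x - real m * (\<integral>t. 1 / (t + row_min b n) \<partial>\<alpha>)\<bar> \<le> \<epsilon> * real m"
      unfolding eventually_sequentially by blast
    then show ?case by (intro exI[of _ "Suc K"]) auto
  qed
  with \<delta> show ?thesis by blast
qed

theorem theorem3p7:
  fixes a b :: "nat \<Rightarrow> nat \<Rightarrow> real"
    and \<omega> :: "nat \<Rightarrow> nat \<Rightarrow> nat \<times> nat \<Rightarrow> (nat \<times> nat \<Rightarrow> real) \<Rightarrow> real"
    and G :: "nat \<Rightarrow> nat \<Rightarrow> (nat \<times> nat \<Rightarrow> real) \<Rightarrow> real"
    and S :: "nat set"
    and \<epsilon> :: real
  defines "G \<equiv> (\<lambda>m n x. last_passage (\<lambda>p. \<omega> m n p x) m n)"
  assumes ab_pos: "\<And>m n i j. m > 0 \<Longrightarrow> n > 0 \<Longrightarrow> i \<in> {1..m} \<Longrightarrow> j \<in> {1..n} \<Longrightarrow> a m i + b n j > 0"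
    and \<omega>_indep: "\<And>m n. m > 0 \<Longrightarrow> n > 0 \<Longrightarrow>
          prob_space.indep_vars exp_coordinates (\<lambda>_. borel) (\<omega> m n) ({1..m} \<times> {1..n})"
    and \<omega>_exp: "\<And>m n i j. m > 0 \<Longrightarrow> n > 0 \<Longrightarrow> i \<in> {1..m} \<Longrightarrow> j \<in> {1..n} \<Longrightarrow>
          distributed exp_coordinates lborel (\<omega> m n (i, j))
            (\<lambda>x. ennreal (exponential_density (a m i + b n j) x))"
    and S_pos: "S \<subseteq> {0<..}"
    and \<epsilon>_pos: "\<epsilon> > 0"
  shows
    "(\<forall>\<alpha>. subprob_space \<alpha> \<and> sets \<alpha> = sets borel \<and> vague_conv (empirical a) \<alpha> \<and>
          inf_row_min a {1..} + inf_row_min b S > 0 \<longrightarrow>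
        (\<exists>\<delta>>0. AE x in exp_coordinates. \<exists>K>0. \<forall>m\<ge>K. \<forall>n\<in>S. real n \<le> \<delta> * real m \<longrightarrow>
           \<bar>G m n x - real m * (\<integral>t. 1 / (t + row_min b n) \<partial>\<alpha>)\<bar> \<le> \<epsilon> * real m)) \<and>
     (\<forall>\<beta>. subprob_space \<beta> \<and> sets \<beta> = sets borel \<and> vague_conv (empirical b) \<beta> \<and>
          inf_row_min b {1..} + inf_row_min a S > 0 \<longrightarrow>
        (\<exists>\<delta>>0. AE x in exp_coordinates. \<exists>K>0. \<forall>n\<ge>K. \<forall>m\<in>S. real m \<le> \<delta> * real n \<longrightarrow>
           \<bar>G m n x - real n * (\<integral>t. 1 / (t + row_min a m) \<partial>\<beta>)\<bar> \<le> \<epsilon> * real n))"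
proof -
  interpret prob_space exp_coordinates by (rule prob_space_exp_coordinates)
  have S: "0 < n" if "n \<in> S" for n using S_pos that by auto
  show ?thesis
  proof (intro conjI allI impI; elim conjE)
    fix \<alpha> :: "real measure"
    assume \<alpha>: "subprob_space \<alpha>" "sets \<alpha> = sets borel" "vague_conv (empirical a) \<alpha>"
      "0 < inf_row_min a {1..} + inf_row_min b S"
    show "\<exists>\<delta>>0. AE x in exp_coordinates. \<exists>K>0. \<forall>m\<ge>K. \<forall>n\<in>S. real n \<le> \<delta> * real m \<longrightarrow>
        \<bar>G m n x - real m * (\<integral>t. 1 / (t + row_min b n) \<partial>\<alpha>)\<bar> \<le> \<epsilon> * real m"
      unfolding G_def
      by (rule last_passage_shape_near_axis[OF _ _ S_pos \<epsilon>_pos \<alpha>]) (use S \<omega>_indep \<omega>_exp in auto)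
  next
    fix \<beta> :: "real measure"
    assume \<beta>: "subprob_space \<beta>" "sets \<beta> = sets borel" "vague_conv (empirical b) \<beta>"
      "0 < inf_row_min b {1..} + inf_row_min a S"
    \<comment> \<open>Reflection in the diagonal exchanges the roles of the two families of parameters.\<close>
    define X where "X n m p = \<omega> m n (prod.swap p)" for n m p
    have G: "G m n x = last_passage (\<lambda>p. X n m p x) n m" for m n x
      by (simp add: G_def X_def last_passage_swap[of _ n m])
    show "\<exists>\<delta>>0. AE x in exp_coordinates. \<exists>K>0. \<forall>n\<ge>K. \<forall>m\<in>S. real m \<le> \<delta> * real n \<longrightarrow>
        \<bar>G m n x - real n * (\<integral>t. 1 / (t + row_min a m) \<partial>\<beta>)\<bar> \<le> \<epsilon> * real n"
      unfolding G
    proof (rule last_passage_shape_near_axis[OF _ _ S_pos \<epsilon>_pos \<beta>])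
      fix n m assume nm: "(0::nat) < n" "m \<in> S"
      have "indep_vars (\<lambda>_. borel) (\<lambda>p. \<omega> m n (prod.swap p)) ({1..n} \<times> {1..m})"
        using \<omega>_indep[OF S[OF nm(2)] nm(1)] by (rule indep_vars_reindex) auto
      then show "indep_vars (\<lambda>_. borel) (X n m) ({1..n} \<times> {1..m})" by (simp add: X_def[abs_def])
      fix j i assume "j \<in> {1..n}" "i \<in> {1..m}"
      then show "distributed exp_coordinates lborel (X n m (j, i))
          (\<lambda>x. ennreal (exponential_density (b n j + a m i) x))"
        using \<omega>_exp[OF S[OF nm(2)] nm(1), of i j] by (simp add: X_def add.commute)
    qed
  qed
qed

end
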